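(* Let $G$ be a finitely generated group with $\operatorname{asdim} G=n$, where $2\le n<\infty$. Then $G$ contains an $n$-asymptotic Cantor manifold, i.e. for a finite generating set $S$ of $G$ the Cayley graph $\operatorname{Cay}(G,S)$ has a subset which, with the restricted metric, is an $n$-asymptotic Cantor manifold.
   Context: Asymptotic dimension: for a metric space $X$ and an integer $n\ge 0$, $\operatorname{asdim} X\le n$ iff for every $R>0$ there is a uniformly bounded covering $\mathcal U$ of $X$ (i.e. $\sup_{U\in\mathcal U}\operatorname{diam}U<\infty$) such that every ball of radius $R$ in $X$ intersects at most $n+1$ elements of $\mathcal U$. Subsets carry the restricted metric. For a finitely generated group $G$, $\operatorname{asdim}G$ is the asymptotic dimension of a Cayley graph $\operatorname{Cay}(G,S)$ ($S$ a finite generating set) with its graph metric; it does not depend on $S$. For $A\subseteq X$, $N_R(A)$ is the set of points of $X$ at distance at most $R$ from $A$. Coarse separation: let $X$ be a metric space and $K\subseteq X$. A component $C$ of $X\setminus N_R(K)$ is deep if $C$ is not contained in $N_{R'}(K)$ for any $R'>0$. The set $K$ coarsely separates $X$ if there is an $R>0$ such that $X\setminus N_R(K)$ has at least two deep connected components. Asymptotic Cantor manifold: a connected metric space $X$ with $\operatorname{asdim}X=n$, $n\ge 2$, is an $n$-asymptotic Cantor manifold if $X$ cannot be coarsely separated by any subset of asymptotic dimension $k$ with $k\le n-2$. *)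

theory Defs
  imports "HOL-Analysis.Abstract_Metric_Spaces" "HOL-Algebra.Generated_Groups"
    "HOL-Library.Extended_Nat"
begin

text \<open>A metric space is given by a carrier set and a distance function, as in the locale
  \<^locale>\<open>Metric_space\<close>; a subset with the restricted metric is a smaller carrier with the same
  distance function.\<close>

section \<open>Asymptotic dimension\<close>

definition uniformly_bounded :: "('p \<Rightarrow> 'p \<Rightarrow> real) \<Rightarrow> 'p set set \<Rightarrow> bool" where
  "uniformly_bounded d \<U> \<longleftrightarrow> (\<exists>D. \<forall>U\<in>\<U>. \<forall>x\<in>U. \<forall>y\<in>U. d x y \<le> D)"

definition asdim_le :: "'p set \<Rightarrow> ('p \<Rightarrow> 'p \<Rightarrow> real) \<Rightarrow> nat \<Rightarrow> bool" where
  "asdim_le M d n \<longleftrightarrow>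
     (\<forall>R>0. \<exists>\<U>. \<Union>\<U> = M \<and> uniformly_bounded d \<U> \<and>
        (\<forall>x\<in>M. finite {U\<in>\<U>. U \<inter> Metric_space.mball M d x R \<noteq> {}} \<and>
               card {U\<in>\<U>. U \<inter> Metric_space.mball M d x R \<noteq> {}} \<le> n + 1))"

text \<open>The value is \<open>\<infinity>\<close> if no bound exists. As only \<open>n \<ge> 0\<close> is considered, the
  empty space has asymptotic dimension 0.\<close>

definition asdim :: "'p set \<Rightarrow> ('p \<Rightarrow> 'p \<Rightarrow> real) \<Rightarrow> enat" where
  "asdim M d = Inf {enat n | n. asdim_le M d n}"

section \<open>Coarse separation and asymptotic Cantor manifolds\<close>

text \<open>The distance from a point to the empty set is read as infinite, so all
  neighbourhoods of the empty set are empty.\<close>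

definition nbhd :: "'p set \<Rightarrow> ('p \<Rightarrow> 'p \<Rightarrow> real) \<Rightarrow> 'p set \<Rightarrow> real \<Rightarrow> 'p set" where
  "nbhd M d A R = {x\<in>M. A \<noteq> {} \<and> (INF a\<in>A. d x a) \<le> R}"

definition deep_components ::
    "'p set \<Rightarrow> ('p \<Rightarrow> 'p \<Rightarrow> real) \<Rightarrow> 'p set \<Rightarrow> real \<Rightarrow> 'p set set" where
  "deep_components M d K R =
     {C \<in> connected_components_of
            (subtopology (Metric_space.mtopology M d) (M - nbhd M d K R)).
        \<forall>R'>0. \<not> C \<subseteq> nbhd M d K R'}"

definition coarsely_separates :: "'p set \<Rightarrow> ('p \<Rightarrow> 'p \<Rightarrow> real) \<Rightarrow> 'p set \<Rightarrow> bool" where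
  "coarsely_separates M d K \<longleftrightarrow>
     (\<exists>R>0. \<exists>C \<in> deep_components M d K R. \<exists>C' \<in> deep_components M d K R. C \<noteq> C')"

definition asymptotic_Cantor_manifold ::
    "nat \<Rightarrow> 'p set \<Rightarrow> ('p \<Rightarrow> 'p \<Rightarrow> real) \<Rightarrow> bool" where
  "asymptotic_Cantor_manifold n M d \<longleftrightarrow>
     Metric_space M d \<and> connected_space (Metric_space.mtopology M d) \<and>
     2 \<le> n \<and> asdim M d = enat n \<and>
     (\<forall>K\<subseteq>M. \<forall>k::nat. asdim K d = enat k \<and> k \<le> n - 2 \<longrightarrow> \<not> coarsely_separates M d K)"

section \<open>Geometric realization of a graph\<close>

text \<open>A point of the realization is its tuple of barycentric coordinates: the vertex \<open>u\<close> is the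
  indicator function of \<open>u\<close>, and \<open>edge_point u v t\<close> is the point at distance \<open>t\<close> from
  \<open>u\<close> on the edge from \<open>u\<close> to \<open>v\<close>.\<close>

definition edge_point :: "'v \<Rightarrow> 'v \<Rightarrow> real \<Rightarrow> 'v \<Rightarrow> real" where
  "edge_point u v t = (\<lambda>x. (1 - t) * of_bool (x = u) + t * of_bool (x = v))"

definition realization :: "'v set \<Rightarrow> ('v \<Rightarrow> 'v \<Rightarrow> bool) \<Rightarrow> ('v \<Rightarrow> real) set" where
  "realization V E = {edge_point u v t | u v t. u \<in> V \<and> v \<in> V \<and> (u = v \<or> E u v) \<and> t \<in> {0..1}}"

text \<open>\<open>path_length E p q l\<close>: there is a path from \<open>p\<close> to \<open>q\<close> of length \<open>l\<close>
  that is a finite concatenation of segments, each inside one closed edge; edges have length 1.\<close>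

inductive path_length :: "('v \<Rightarrow> 'v \<Rightarrow> bool) \<Rightarrow> ('v \<Rightarrow> real) \<Rightarrow> ('v \<Rightarrow> real) \<Rightarrow> real \<Rightarrow> bool"
  for E where
  refl: "path_length E p p 0"
| step: "E u v \<Longrightarrow> s \<in> {0..1} \<Longrightarrow> t \<in> {0..1} \<Longrightarrow> path_length E (edge_point u v t) q l \<Longrightarrow>
         path_length E (edge_point u v s) q (\<bar>s - t\<bar> + l)"

text \<open>The value 0 for points not joined by a path is a dummy; it does not occur in the
  realization of a connected graph.\<close>

definition graph_dist :: "('v \<Rightarrow> 'v \<Rightarrow> bool) \<Rightarrow> ('v \<Rightarrow> real) \<Rightarrow> ('v \<Rightarrow> real) \<Rightarrow> real" where
  "graph_dist E p q = (if \<exists>l. path_length E p q l then Inf {l. path_length E p q l} else 0)"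

section \<open>Cayley graphs\<close>

definition generating_set :: "('a, 'b) monoid_scheme \<Rightarrow> 'a set \<Rightarrow> bool" where
  "generating_set G S \<longleftrightarrow> S \<subseteq> carrier G \<and> generate G S = carrier G"

text \<open>\<open>S\<close> need not be symmetric or avoid the unit: the Cayley graph is the simple undirected
  graph joining \<open>g\<close> to \<open>g \<otimes> s\<close>.\<close>

definition Cayley_adj :: "('a, 'b) monoid_scheme \<Rightarrow> 'a set \<Rightarrow> 'a \<Rightarrow> 'a \<Rightarrow> bool" where
  "Cayley_adj G S g h \<longleftrightarrow> g \<in> carrier G \<and> h \<in> carrier G \<and> g \<noteq> h \<and>
     (\<exists>s\<in>S. h = g \<otimes>\<^bsub>G\<^esub> s \<or> g = h \<otimes>\<^bsub>G\<^esub> s)"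

definition Cay :: "('a, 'b) monoid_scheme \<Rightarrow> 'a set \<Rightarrow> ('a \<Rightarrow> real) set" where
  "Cay G S = realization (carrier G) (Cayley_adj G S)"

definition Cay_dist :: "('a, 'b) monoid_scheme \<Rightarrow> 'a set \<Rightarrow> ('a \<Rightarrow> real) \<Rightarrow> ('a \<Rightarrow> real) \<Rightarrow> real" where
  "Cay_dist G S = graph_dist (Cayley_adj G S)"

subsection \<open>The Cayley graph of a group is a metric space\<close>

lemma path_length_ge: "path_length E p q l \<Longrightarrow> \<bar>p x - q x\<bar> \<le> l"
proof (induction rule: path_length.induct)
  case (step u v s t q l)
  have "edge_point u v s x - edge_point u v t x = (s - t) * (of_bool (x = v) - of_bool (x = u))"
    by (simp add: edge_point_def algebra_simps)
  then have "\<bar>edge_point u v s x - edge_point u v t x\<bar> \<le> \<bar>s - t\<bar>"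
    by (auto simp: abs_mult)
  with step.IH show ?case by linarith
qed simp

lemma path_length_trans:
  "path_length E p q l \<Longrightarrow> path_length E q r m \<Longrightarrow> path_length E p r (l + m)"
proof (induction rule: path_length.induct)
  case (step u v s t q l)
  then show ?case using path_length.step[of E u v s t r "l + m"] by (simp add: add.assoc)
qed simp

lemma path_length_sym: "path_length E p q l \<Longrightarrow> path_length E q p l"
proof (induction rule: path_length.induct)
  case (step u v s t q l)
  have "path_length E (edge_point u v t) (edge_point u v s) (\<bar>t - s\<bar> + 0)"
    using step.hyps by (intro path_length.step path_length.refl)
  from path_length_trans[OF step.IH this] show ?case
    by (simp add: abs_minus_commute add.commute)
qed (rule path_length.refl)

lemma path_length_nonneg: "path_length E p q l \<Longrightarrow> 0 \<le> l"
  using path_length_ge[of E p q l undefined] by linarith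

lemma graph_dist_metric:
  assumes conn: "\<And>p q. p \<in> M \<Longrightarrow> q \<in> M \<Longrightarrow> \<exists>l. path_length E p q l"
  shows "Metric_space M (graph_dist E)"
proof
  have bdd: "bdd_below {l. path_length E p q l}" for p q
    by (rule bdd_belowI[of _ 0]) (auto dest: path_length_nonneg)
  show "0 \<le> graph_dist E p q" for p q
    unfolding graph_dist_def by (auto intro!: cInf_greatest dest: path_length_nonneg)
  have "path_length E p q l \<longleftrightarrow> path_length E q p l" for p q l
    using path_length_sym by blast
  then show "graph_dist E p q = graph_dist E q p" for p q
    unfolding graph_dist_def by presburger
  show "graph_dist E p q = 0 \<longleftrightarrow> p = q" if "p \<in> M" "q \<in> M" for p q
  proof
    assume 0: "graph_dist E p q = 0"
    have "\<bar>p x - q x\<bar> \<le> graph_dist E p q" for x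
      using conn[OF that] unfolding graph_dist_def
      by (auto intro!: cInf_greatest dest: path_length_ge)
    with 0 show "p = q" by fastforce
  next
    assume "p = q"
    then have "path_length E p q 0" by (simp add: path_length.refl)
    then show "graph_dist E p q = 0" unfolding graph_dist_def
      by (auto intro!: cInf_eq_minimum dest: path_length_nonneg)
  qed
  show "graph_dist E p r \<le> graph_dist E p q + graph_dist E q r"
    if "p \<in> M" "q \<in> M" "r \<in> M" for p q r
  proof -
    note c = conn[OF that(1,2)] conn[OF that(2,3)] conn[OF that(1,3)]
    have *: "graph_dist E p r \<le> l + m" if "path_length E p q l" "path_length E q r m" for l m
      using c(3) path_length_trans[OF that] bdd unfolding graph_dist_def
      by (auto intro!: cInf_lower)
    have "graph_dist E p r - l \<le> graph_dist E q r" if "path_length E p q l" for l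
    proof -
      have "graph_dist E p r - l \<le> Inf {m. path_length E q r m}"
        using c(2) *[OF that] by (intro cInf_greatest) (auto simp: diff_le_eq add.commute)
      then show ?thesis using c(2) by (simp add: graph_dist_def[of E q r])
    qed
    then have "graph_dist E p r - graph_dist E q r \<le> l" if "path_length E p q l" for l
      using that by (fastforce simp: algebra_simps)
    then have "graph_dist E p r - graph_dist E q r \<le> graph_dist E p q"
      using c(1) unfolding graph_dist_def[of E p q] by (auto intro!: cInf_greatest)
    then show ?thesis by simp
  qed
qed

lemma Cay_metric:
  assumes "group G" and "generating_set G S"
  shows "Metric_space (Cay G S) (Cay_dist G S)"
proof -
  interpret group G by fact
  have S: "S \<subseteq> carrier G" "generate G S = carrier G"
    using assms(2) by (auto simp: generating_set_def)
  define E where "E = Cayley_adj G S"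
  define J where "J p q \<longleftrightarrow> (\<exists>l. path_length E p q l)" for p q
  have J_refl: "J p p" for p unfolding J_def by (blast intro: path_length.refl)
  have J_sym: "J p q \<Longrightarrow> J q p" for p q unfolding J_def by (blast intro: path_length_sym)
  have J_trans: "J p q \<Longrightarrow> J q r \<Longrightarrow> J p r" for p q r
    unfolding J_def by (blast intro: path_length_trans)
  have J_edge: "J (edge_point u v s) (edge_point u v t)" if "E u v" "s \<in> {0..1}" "t \<in> {0..1}" for u v s t
    unfolding J_def using that by (blast intro: path_length.intros)
  define \<delta> :: "'a \<Rightarrow> 'a \<Rightarrow> real" where "\<delta> g = edge_point g g 0" for g
  have ep0: "edge_point u v 0 = \<delta> u" and ep1: "edge_point u v 1 = \<delta> v"
    and epr: "edge_point u u t = \<delta> u" for u v t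
    by (auto simp: edge_point_def \<delta>_def algebra_simps)
  have J_adj: "J (\<delta> u) (\<delta> v)" if "E u v" for u v
    using J_edge[OF that, of 0 1] by (simp add: ep0 ep1)
  have gen: "J (\<delta> g) (\<delta> (g \<otimes>\<^bsub>G\<^esub> h))" if "h \<in> generate G S" "g \<in> carrier G" for g h
    using that
  proof (induction arbitrary: g rule: generate.induct)
    case one
    then show ?case by (simp add: J_refl)
  next
    case (incl h)
    then show ?case using S J_adj[of g "g \<otimes>\<^bsub>G\<^esub> h"] J_refl
      by (cases "g = g \<otimes>\<^bsub>G\<^esub> h") (auto simp: E_def Cayley_adj_def)
  next
    case (inv h)
    then have "g \<otimes>\<^bsub>G\<^esub> inv\<^bsub>G\<^esub> h \<otimes>\<^bsub>G\<^esub> h = g" "h \<in> carrier G" using S by (auto simp: m_assoc)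
    moreover from this have "\<exists>s\<in>S. g = g \<otimes>\<^bsub>G\<^esub> inv\<^bsub>G\<^esub> h \<otimes>\<^bsub>G\<^esub> s"
      using inv by metis
    ultimately show ?case
      using inv J_adj[of g "g \<otimes>\<^bsub>G\<^esub> inv\<^bsub>G\<^esub> h"] J_refl
      by (cases "g = g \<otimes>\<^bsub>G\<^esub> inv\<^bsub>G\<^esub> h") (auto simp: E_def Cayley_adj_def)
  next
    case (eng h1 h2)
    then have "h1 \<in> carrier G" "h2 \<in> carrier G" using S by auto
    with eng.IH(1)[of g] eng.IH(2)[of "g \<otimes>\<^bsub>G\<^esub> h1"] eng.prems show ?case
      by (auto simp: m_assoc intro: J_trans)
  qed
  have vert: "J (\<delta> g) (\<delta> \<one>\<^bsub>G\<^esub>)" if "g \<in> carrier G" for g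
    using gen[of g "\<one>\<^bsub>G\<^esub>"] that S by (auto intro: J_sym)
  have "J p (\<delta> \<one>\<^bsub>G\<^esub>)" if "p \<in> Cay G S" for p
  proof -
    obtain u v t where p: "p = edge_point u v t" "u \<in> carrier G" "u = v \<or> E u v" "t \<in> {0..1}"
      using \<open>p \<in> Cay G S\<close> unfolding Cay_def realization_def E_def by blast
    then have "J p (\<delta> u)"
      using J_edge[of u v t 0] J_refl by (auto simp: ep0 epr)
    then show ?thesis using vert[OF p(2)] J_trans by blast
  qed
  then have "J p q" if "p \<in> Cay G S" "q \<in> Cay G S" for p q
    using that J_sym J_trans by blast
  then show ?thesis
    unfolding Cay_dist_def E_def[symmetric] J_def by (rule graph_dist_metric)
qed

end

(* The manifold is the full subgraph X on a geodesic ray with sparsely placed translated balls of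
   every radius attached to it. Finite subsets of the Cayley graph embed isometrically in X, and
   asdim \<le> n is inherited from finite subsets by compactness, so asdim X = n. Between the balls X
   is just an edge of the ray. Hence it has cut points at arbitrarily large distance from the unit,
   and every unbounded connected subset contains all but a bounded set of them, so no two deep
   components are disjoint. *)
theory Submission
  imports Defs "HOL-Analysis.Function_Topology"
begin

text \<open>A subset of full asymptotic dimension need not contain a copy of the Cayley graph:
  arbitrarily large pieces of it suffice, and left multiplication carries any finite piece into one
  of the balls. Since X has the restricted metric, such a translation preserves distances exactly,
  whatever paths X itself offers. A covering of X pulled back along these translations has no reason
  to converge as a family of sets, because the pieces drift off to infinity; what has a limit is the
  relation of lying in the same member, a Boolean function on pairs. The ray is geodesic so that it
  meets every level of word length exactly once, and a ball of radius i centred at level m spans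
  only the levels m - i to m + i. In a gap two consecutive levels k and k + 1 then hold one vertex
  each, and the only point at height k + 1/2 is the midpoint of the edge between them.\<close>

section \<open>Asymptotic dimension and finite subsets\<close>

lemma compact_UNIV_fun_bool: "compact (UNIV :: ('p \<Rightarrow> bool) set)"
proof -
  have "compact_space (euclidean :: bool topology)"
    by (simp add: compact_space_def finite_imp_compact)
  then have "compact_space (product_topology (\<lambda>_::'p. euclidean :: bool topology) UNIV)"
    by (simp add: compact_space_product_topology)
  then show ?thesis
    by (simp add: euclidean_product_topology compact_space_def)
qed

text \<open>\<open>E0\<close> is a cluster point of the maps \<open>E F\<close> along the finite subsets \<open>F\<close> of \<open>M\<close>, in the compact
  space of Boolean functions.\<close>

lemma finite_approximation:
  fixes E :: "'p set \<Rightarrow> 'q \<Rightarrow> bool"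
  shows "\<exists>E0. \<forall>A Q. finite A \<longrightarrow> A \<subseteq> M \<longrightarrow> finite Q \<longrightarrow>
      (\<exists>F. finite F \<and> A \<subseteq> F \<and> F \<subseteq> M \<and> (\<forall>q\<in>Q. E F q = E0 q))"
proof -
  define Fl where "Fl = filtermap E (finite_subsets_at_top M)"
  have "Fl \<noteq> bot" by (simp add: Fl_def filtermap_bot_iff)
  moreover have "\<forall>\<^sub>F x in Fl. x \<in> UNIV" by simp
  ultimately obtain E0 where E0: "inf (nhds E0) Fl \<noteq> bot"
    using compact_UNIV_fun_bool[unfolded compact_filter] by blast
  have "\<exists>F. finite F \<and> A \<subseteq> F \<and> F \<subseteq> M \<and> (\<forall>q\<in>Q. E F q = E0 q)"
    if "finite A" "A \<subseteq> M" "finite Q" for A Q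
  proof -
    \<comment> \<open>Agreement with \<open>E0\<close> on \<open>Q\<close> restricts only finitely
      many coordinates, so it is an open condition in the product topology.\<close>
    have "{q. (if q \<in> Q then {E0 q} else UNIV) \<noteq> UNIV} \<subseteq> Q" by auto
    then have "open (Pi\<^sub>E UNIV (\<lambda>q. if q \<in> Q then {E0 q} else UNIV))"
      using that(3) by (intro open_PiE) (auto simp: open_discrete intro: finite_subset)
    then have "\<forall>\<^sub>F E' in nhds E0. E' \<in> Pi\<^sub>E UNIV (\<lambda>q. if q \<in> Q then {E0 q} else UNIV)"
      by (rule eventually_nhds_in_open) auto
    then have 1: "\<forall>\<^sub>F E' in nhds E0. \<forall>q\<in>Q. E' q = E0 q"
      by (rule eventually_mono) (auto simp: PiE_iff split: if_splits)
    have 2: "\<forall>\<^sub>F E' in Fl. \<exists>F. finite F \<and> A \<subseteq> F \<and> F \<subseteq> M \<and> E' = E F"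
      unfolding Fl_def eventually_filtermap eventually_finite_subsets_at_top
      using that by blast
    have "\<forall>\<^sub>F E' in inf (nhds E0) Fl. (\<forall>q\<in>Q. E' q = E0 q) \<and>
        (\<exists>F. finite F \<and> A \<subseteq> F \<and> F \<subseteq> M \<and> E' = E F)"
      unfolding eventually_inf using 1 2 by blast
    from eventually_happens'[OF E0 this] show ?thesis by metis
  qed
  then show ?thesis by blast
qed

text \<open>The cover of \<open>M\<close> consists of the classes of an equivalence relation \<open>E\<close> that on each finite set
  agrees with lying in the same member of the cover of \<open>X\<close> after an embedding of a larger finite set.\<close>

lemma asdim_le_finite_embed:
  fixes M :: "'p set" and X :: "'q set"
  assumes M: "Metric_space M d" and X: "Metric_space X d'" and le: "asdim_le X d' n"
    and emb: "\<And>F. finite F \<Longrightarrow> F \<subseteq> M \<Longrightarrow>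
        \<exists>T. T ` F \<subseteq> X \<and> (\<forall>x\<in>F. \<forall>y\<in>F. d' (T x) (T y) = d x y)"
  shows "asdim_le M d n"
  unfolding asdim_le_def
proof (intro allI impI)
  fix R :: real assume "R > 0"
  interpret M: Metric_space M d by fact
  interpret X: Metric_space X d' by fact
  obtain \<U> where U: "\<Union>\<U> = X" "uniformly_bounded d' \<U>"
    and mult: "\<And>x. x \<in> X \<Longrightarrow> finite {U\<in>\<U>. U \<inter> X.mball x R \<noteq> {}}"
      "\<And>x. x \<in> X \<Longrightarrow> card {U\<in>\<U>. U \<inter> X.mball x R \<noteq> {}} \<le> n + 1"
    using le \<open>R > 0\<close> unfolding asdim_le_def by meson
  have "\<forall>x\<in>X. \<exists>U. U \<in> \<U> \<and> x \<in> U" using U(1) by blast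
  \<comment> \<open>One chosen member per point turns the cover into a partition whose parts lie
    inside members, so neither the diameter bound nor the multiplicity gets worse.\<close>
  then obtain c where c: "\<And>x. x \<in> X \<Longrightarrow> c x \<in> \<U> \<and> x \<in> c x" by metis
  obtain D where D: "\<And>U x y. U \<in> \<U> \<Longrightarrow> x \<in> U \<Longrightarrow> y \<in> U \<Longrightarrow> d' x y \<le> D"
    using U(2) unfolding uniformly_bounded_def by blast
  obtain T where T: "\<And>F x. finite F \<Longrightarrow> F \<subseteq> M \<Longrightarrow> x \<in> F \<Longrightarrow> T F x \<in> X"
    "\<And>F x y. finite F \<Longrightarrow> F \<subseteq> M \<Longrightarrow> x \<in> F \<Longrightarrow> y \<in> F \<Longrightarrow> d' (T F x) (T F y) = d x y"
    using emb by (metis image_subset_iff)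
  \<comment> \<open>Outside \<open>F\<close> the map \<open>T F\<close> is arbitrary; this is
    harmless, since \<open>E\<close> is only compared on a finite set \<open>A\<close> contained in
    \<open>F\<close>.\<close>
  obtain E where E0: "\<forall>A Q. finite A \<longrightarrow> A \<subseteq> M \<longrightarrow> finite Q \<longrightarrow> (\<exists>F. finite F \<and> A \<subseteq> F \<and>
      F \<subseteq> M \<and> (\<forall>q\<in>Q. (case q of (x, y) \<Rightarrow> c (T F x) = c (T F y)) = E q))"
    using finite_approximation[of M "\<lambda>F (x, y). c (T F x) = c (T F y)"] by (rule exE)
  have E: "\<exists>F. finite F \<and> A \<subseteq> F \<and> F \<subseteq> M \<and> (\<forall>x\<in>A. \<forall>y\<in>A. c (T F x) = c (T F y) \<longleftrightarrow> E (x, y))"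
    if "finite A" "A \<subseteq> M" for A
  proof -
    have "finite (A \<times> A)" using that by simp
    from E0[rule_format, OF that this] obtain F where F: "finite F" "A \<subseteq> F" "F \<subseteq> M"
      and q: "\<forall>q\<in>A \<times> A. (case q of (x, y) \<Rightarrow> c (T F x) = c (T F y)) = E q" by (elim exE conjE)
    have "c (T F x) = c (T F y) \<longleftrightarrow> E (x, y)" if "x \<in> A" "y \<in> A" for x y
      using bspec[OF q, of "(x, y)"] that by simp
    with F show ?thesis by (intro exI[of _ F] conjI) simp_all
  qed
  \<comment> \<open>On a finite set \<open>E\<close> is the kernel of a function, so the laws of an
    equivalence relation follow from those of equality.\<close>
  have E_fun: "\<exists>f::'p \<Rightarrow> 'q set. \<forall>x\<in>A. \<forall>y\<in>A. f x = f y \<longleftrightarrow> E (x, y)" if "finite A" "A \<subseteq> M" for A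
  proof -
    from E[OF that] obtain F where "\<forall>x\<in>A. \<forall>y\<in>A. c (T F x) = c (T F y) \<longleftrightarrow> E (x, y)"
      by (elim exE conjE)
    then show ?thesis by (rule exI[of _ "\<lambda>x. c (T F x)"])
  qed
  have E_sym: "E (y, x)" if "E (x, y)" "x \<in> M" "y \<in> M" for x y
  proof -
    have "finite {x, y}" "{x, y} \<subseteq> M" using that by auto
    from E_fun[OF this] obtain f :: "'p \<Rightarrow> 'q set" where
      "\<forall>u\<in>{x, y}. \<forall>v\<in>{x, y}. f u = f v \<longleftrightarrow> E (u, v)" ..
    with that(1) show ?thesis by (metis insertI1 insertI2)
  qed
  have E_trans: "E (x, z)" if "E (x, y)" "E (y, z)" "x \<in> M" "y \<in> M" "z \<in> M" for x y z
  proof -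
    have "finite {x, y, z}" "{x, y, z} \<subseteq> M" using that by auto
    from E_fun[OF this] obtain f :: "'p \<Rightarrow> 'q set" where
      "\<forall>u\<in>{x, y, z}. \<forall>v\<in>{x, y, z}. f u = f v \<longleftrightarrow> E (u, v)" ..
    with that(1,2) show ?thesis by (metis insertI1 insertI2)
  qed
  have E_refl: "E (x, x)" if "x \<in> M" for x
  proof -
    have "finite {x}" "{x} \<subseteq> M" using that by auto
    from E_fun[OF this] obtain f :: "'p \<Rightarrow> 'q set" where
      "\<forall>u\<in>{x}. \<forall>v\<in>{x}. f u = f v \<longleftrightarrow> E (u, v)" ..
    then show ?thesis by simp
  qed
  define cl where "cl x = {y\<in>M. E (x, y)}" for x
  have cl_eq: "cl x = cl y" if "x \<in> M" "y \<in> M" "E (x, y)" for x y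
    using that E_sym E_trans unfolding cl_def by blast
  have d_le: "d y z \<le> D" if xyz: "x \<in> M" "y \<in> cl x" "z \<in> cl x" for x y z
  proof -
    have "y \<in> M" "z \<in> M" "E (x, y)" "E (x, z)" using xyz unfolding cl_def by auto
    moreover have "finite {x, y, z}" "{x, y, z} \<subseteq> M" using xyz(1) calculation by auto
    from E[OF this] obtain F where F: "finite F" "{x, y, z} \<subseteq> F" "F \<subseteq> M"
      "\<forall>u\<in>{x, y, z}. \<forall>v\<in>{x, y, z}. c (T F u) = c (T F v) \<longleftrightarrow> E (u, v)"
      by (elim exE conjE)
    ultimately have c_eq: "c (T F x) = c (T F y)" "c (T F x) = c (T F z)"
      by (metis insertI1 insertI2)+
    have "T F y \<in> c (T F x)" "T F z \<in> c (T F x)" "c (T F x) \<in> \<U>"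
      using c[OF T(1)[OF F(1,3)]] F(2) c_eq by (metis insert_subset)+
    then have "d' (T F y) (T F z) \<le> D"
      using D by blast
    then show ?thesis using T(2)[OF F(1,3)] F(2) by auto
  qed
  \<comment> \<open>Restricted to finite families of classes, because finiteness of the whole family
    meeting a ball is still open; an infinite one would contain a family of \<open>n + 2\<close>
    classes.\<close>
  have card_le: "card \<V> \<le> n + 1"
    if x: "x \<in> M" and V: "finite \<V>" "\<V> \<subseteq> {U \<in> cl ` M. U \<inter> M.mball x R \<noteq> {}}" for x \<V>
  proof -
    have "\<forall>U\<in>\<V>. \<exists>y. y \<in> U \<and> y \<in> M.mball x R" using V(2) by blast
    then obtain f where f: "\<And>U. U \<in> \<V> \<Longrightarrow> f U \<in> U \<and> f U \<in> M.mball x R" by metis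
    have fM: "f U \<in> M" "cl (f U) = U" if U: "U \<in> \<V>" for U
    proof -
      obtain z where z: "z \<in> M" "U = cl z" using V(2) U by auto
      with f[OF U] have "f U \<in> M" "E (z, f U)" by (auto simp: cl_def)
      with z cl_eq show "f U \<in> M" "cl (f U) = U" by auto
    qed
    have "finite (insert x (f ` \<V>))" "insert x (f ` \<V>) \<subseteq> M" using V(1) x fM(1) by auto
    from E[OF this] obtain F where F: "finite F" "insert x (f ` \<V>) \<subseteq> F" "F \<subseteq> M"
      "\<forall>y\<in>insert x (f ` \<V>). \<forall>z\<in>insert x (f ` \<V>). c (T F y) = c (T F z) \<longleftrightarrow> E (y, z)"
      by (elim exE conjE)
    \<comment> \<open>The representatives \<open>f U\<close> inside the ball are moved together with
      its centre \<open>x\<close>. Distinct classes receive distinct members, all meeting the ball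
      around \<open>T F x\<close>, where the multiplicity is known.\<close>
    let ?g = "\<lambda>U. c (T F (f U))"
    have "inj_on ?g \<V>"
    proof (rule inj_onI)
      fix U U' assume *: "U \<in> \<V>" "U' \<in> \<V>" "?g U = ?g U'"
      then have "E (f U, f U')" using F(4) by blast
      with * show "U = U'" using fM cl_eq by metis
    qed
    have "?g U \<in> {U\<in>\<U>. U \<inter> X.mball (T F x) R \<noteq> {}}" if "U \<in> \<V>" for U
    proof -
      have "T F (f U) \<in> X" "T F x \<in> X" "d' (T F x) (T F (f U)) = d x (f U)"
        using T[OF F(1,3)] F(2) that by auto
      moreover have "d x (f U) < R" using f[OF that] by simp
      ultimately have "T F (f U) \<in> c (T F (f U)) \<inter> X.mball (T F x) R" "c (T F (f U)) \<in> \<U>"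
        using c by auto
      then show ?thesis by blast
    qed
    then have "?g ` \<V> \<subseteq> {U\<in>\<U>. U \<inter> X.mball (T F x) R \<noteq> {}}" by blast
    moreover have "T F x \<in> X" using T(1)[OF F(1,3)] F(2) by auto
    ultimately show ?thesis
      using mult[of "T F x"] card_image[OF \<open>inj_on ?g \<V>\<close>] card_mono
      by (metis (no_types, lifting) le_trans)
  qed
  show "\<exists>\<U>. \<Union>\<U> = M \<and> uniformly_bounded d \<U> \<and>
      (\<forall>x\<in>M. finite {U\<in>\<U>. U \<inter> M.mball x R \<noteq> {}} \<and> card {U\<in>\<U>. U \<inter> M.mball x R \<noteq> {}} \<le> n + 1)"
  proof (intro exI conjI ballI)
    show "\<Union>(cl ` M) = M" using E_refl by (auto simp: cl_def)
    show "uniformly_bounded d (cl ` M)"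
      unfolding uniformly_bounded_def using d_le by blast
    fix x assume x: "x \<in> M"
    let ?S = "{U \<in> cl ` M. U \<inter> M.mball x R \<noteq> {}}"
    show fin: "finite ?S"
    proof (rule ccontr)
      assume "infinite ?S"
      then obtain \<V> where "\<V> \<subseteq> ?S" "finite \<V>" "card \<V> = n + 2"
        using infinite_arbitrarily_large by blast
      with card_le[OF x] show False by fastforce
    qed
    show "card ?S \<le> n + 1" using card_le[OF x fin] by simp
  qed
qed

text \<open>The inclusion serves as the isometric embedding of every finite subset.\<close>

lemma asdim_le_subset:
  assumes "Metric_space M d" "X \<subseteq> M" "asdim_le M d n"
  shows "asdim_le X d n"
proof (rule asdim_le_finite_embed[OF _ assms(1,3)])
  show "Metric_space X d" using assms(1,2) by (rule Metric_space.subspace)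
  show "\<exists>T. T ` F \<subseteq> M \<and> (\<forall>x\<in>F. \<forall>y\<in>F. d (T x) (T y) = d x y)" if "F \<subseteq> X" for F
    using that assms(2) by (intro exI[of _ "\<lambda>x. x"]) auto
qed

section \<open>Cut points prevent coarse separation\<close>

text \<open>Every unbounded connected set contains all cut points from some level on.\<close>

lemma not_coarsely_separates_if_cut_points:
  assumes X: "Metric_space X d" and conn: "connected_space (Metric_space.mtopology X d)"
    and cont: "continuous_map (Metric_space.mtopology X d) euclideanreal h"
    and bdd: "\<And>r. Metric_space.mbounded X d {x\<in>X. h x \<le> r}"
    and cut: "\<And>r. \<exists>s\<ge>r. \<exists>p. {x\<in>X. h x = s} \<subseteq> {p}"
    and K: "K \<subseteq> X"
  shows "\<not> coarsely_separates X d K"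
proof
  interpret X: Metric_space X d by fact
  assume "coarsely_separates X d K"
  then obtain R C C' where C: "C \<in> deep_components X d K R" "C' \<in> deep_components X d K R" "C \<noteq> C'"
    unfolding coarsely_separates_def by blast
  let ?Y = "subtopology X.mtopology (X - nbhd X d K R)"
  have comp: "C \<in> connected_components_of ?Y" "C' \<in> connected_components_of ?Y"
    using C unfolding deep_components_def by auto
  have disj: "C \<inter> C' = {}"
    using pairwise_disjoint_connected_components_of[of ?Y] comp C(3)
    by (auto simp: pairwise_def disjnt_def)
  \<comment> \<open>A point of \<open>K\<close> is needed below to measure depth. For
    \<open>K = {}\<close> the complement is all of \<open>X\<close>, which is connected.\<close>
  have "K \<noteq> {}"
  proof
    assume "K = {}"
    then have "?Y = X.mtopology" by (simp add: nbhd_def subtopology_superset)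
    with comp conn C(3) show False
      by (metis connected_components_of_eq_singleton connected_space_iff_components_eq)
  qed
  then obtain a where a: "a \<in> K" "a \<in> X" using K by blast
  \<comment> \<open>A bounded set lies in a neighbourhood of any single point of \<open>K\<close>,
    so a deep component leaves every sublevel set of \<open>h\<close>; being connected, it takes
    every value from \<open>h b\<close> upwards.\<close>
  have cross: "\<exists>q\<in>B. h q = s" if B: "B \<in> deep_components X d K R" and b: "b \<in> B" "h b \<le> s" for B b s
  proof -
    have Bc: "B \<in> connected_components_of ?Y" and deep: "\<And>R'. R' > 0 \<Longrightarrow> \<not> B \<subseteq> nbhd X d K R'"
      using B unfolding deep_components_def by auto
    have BX: "B \<subseteq> X" using connected_components_of_subset[OF Bc] by auto
    have "connectedin X.mtopology B"
      using connectedin_connected_components_of[OF Bc] by (simp add: connectedin_subtopology)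
    then have "connected (h ` B)"
      using connectedin_continuous_map_image[OF cont] by simp
    moreover have "\<exists>q\<in>B. s < h q"
    proof (rule ccontr)
      assume "\<not> (\<exists>q\<in>B. s < h q)"
      then have "B \<subseteq> {x\<in>X. h x \<le> s}" using BX by force
      then have "X.mbounded B" using bdd X.mbounded_subset by blast
      then obtain D where D: "\<And>x. x \<in> B \<Longrightarrow> d a x \<le> D" "D > 0"
        unfolding X.mbounded_alt_pos using X.mbounded_alt_pos[of "insert a B"] X.mbounded_insert a
        by (metis insertI1 insertI2 \<open>X.mbounded B\<close>)
      have "x \<in> nbhd X d K D" if "x \<in> B" for x
      proof -
        have "(INF b\<in>K. d x b) \<le> d x a"
          using a by (intro cINF_lower bdd_belowI[of _ 0]) auto
        also have "\<dots> \<le> D" using D(1)[OF that] by (simp add: X.commute)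
        finally show ?thesis using that BX \<open>K \<noteq> {}\<close> by (auto simp: nbhd_def)
      qed
      with deep[OF D(2)] show False by blast
    qed
    then obtain q where q: "q \<in> B" "s < h q" by blast
    ultimately have "{h b..h q} \<subseteq> h ` B"
      using b(1) by (intro connected_contains_Icc) auto
    moreover have "s \<in> {h b..h q}" using b(2) q(2) by simp
    ultimately show ?thesis by blast
  qed
  obtain b b' where b: "b \<in> C" "b' \<in> C'"
    using comp nonempty_connected_components_of by (metis ex_in_conv)
  \<comment> \<open>Above the heights of both \<open>b\<close> and \<open>b'\<close>, the two
    components have to pass through the same point \<open>p\<close>.\<close>
  obtain s p where s: "max (h b) (h b') \<le> s" "{x\<in>X. h x = s} \<subseteq> {p}"
    using cut by blast
  obtain q q' where "q \<in> C" "h q = s" "q' \<in> C'" "h q' = s"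
    using cross[OF C(1) b(1), of s] cross[OF C(2) b(2), of s] s(1) by auto
  moreover have "C \<subseteq> X" "C' \<subseteq> X"
    using connected_components_of_subset[OF comp(1)] connected_components_of_subset[OF comp(2)] by auto
  ultimately show False using s(2) disj by blast
qed

section \<open>Points and affine functions on a geometric realization\<close>

lemma edge_point_swap: "edge_point u v t = edge_point v u (1 - t)"
  by (auto simp: edge_point_def)

definition vertex :: "'v \<Rightarrow> 'v \<Rightarrow> real" where
  "vertex v = edge_point v v 0"

lemma edge_point_vertex: "edge_point u v 0 = vertex u" "edge_point u v 1 = vertex v"
  "edge_point u u t = vertex u"
  by (auto simp: vertex_def edge_point_def algebra_simps)

lemma realization_mono: "W \<subseteq> V \<Longrightarrow> realization W E \<subseteq> realization V E"
  unfolding realization_def by blast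

lemma edge_point_in_realization:
  "u \<in> V \<Longrightarrow> v \<in> V \<Longrightarrow> u = v \<or> E u v \<Longrightarrow> t \<in> {0..1} \<Longrightarrow> edge_point u v t \<in> realization V E"
  unfolding realization_def by blast

lemma vertex_in_realization: "u \<in> V \<Longrightarrow> vertex u \<in> realization V E"
  using edge_point_in_realization[of u V u E 0] by (simp add: vertex_def)

lemma realizationE:
  assumes "p \<in> realization V E"
  obtains u v t where "p = edge_point u v t" "u \<in> V" "v \<in> V" "u = v \<or> E u v" "0 \<le> t" "t \<le> 1"
  using assms unfolding realization_def by auto

lemma graph_dist_le: "path_length E p q l \<Longrightarrow> graph_dist E p q \<le> l"
  unfolding graph_dist_def
  by (auto intro!: cInf_lower bdd_belowI[of _ 0] dest: path_length_nonneg)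

lemma graph_dist_ge:
  assumes "path_length E p q l" and "\<And>l. path_length E p q l \<Longrightarrow> a \<le> l"
  shows "a \<le> graph_dist E p q"
  using assms unfolding graph_dist_def by (auto intro!: cInf_greatest)

text \<open>The extension of \<open>f\<close> from the vertices that is affine on every edge.
  Summing over the support of the barycentric coordinates makes it depend on the point alone, not on
  a presentation as \<open>edge_point u v t\<close>.\<close>

definition affine_ext :: "('v \<Rightarrow> nat) \<Rightarrow> ('v \<Rightarrow> real) \<Rightarrow> real" where
  "affine_ext f p = (\<Sum>x | p x \<noteq> 0. p x * real (f x))"

lemma affine_ext_edge_point: "affine_ext f (edge_point u v t) = (1 - t) * real (f u) + t * real (f v)"
proof -
  have "affine_ext f (edge_point u v t) = (\<Sum>x\<in>{u, v}. edge_point u v t x * real (f x))"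
    unfolding affine_ext_def by (rule sum.mono_neutral_left) (auto simp: edge_point_def)
  also have "\<dots> = (1 - t) * real (f u) + t * real (f v)"
    by (cases "u = v") (auto simp: edge_point_def algebra_simps)
  finally show ?thesis .
qed

text \<open>On an edge from \<open>u\<close> to \<open>v\<close> the slope is
  \<open>f v - f u\<close>, so a segment of a path changes the value by at most its length.\<close>

lemma affine_ext_lipschitz:
  assumes f: "\<And>u v. E u v \<Longrightarrow> \<bar>real (f u) - real (f v)\<bar> \<le> 1"
  shows "path_length E p q l \<Longrightarrow> \<bar>affine_ext f p - affine_ext f q\<bar> \<le> l"
proof (induction rule: path_length.induct)
  case (step u v s t q l)
  have "affine_ext f (edge_point u v s) - affine_ext f (edge_point u v t)
      = (s - t) * (real (f v) - real (f u))"
    by (simp add: affine_ext_edge_point algebra_simps)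
  then have "\<bar>affine_ext f (edge_point u v s) - affine_ext f (edge_point u v t)\<bar>
      = \<bar>s - t\<bar> * \<bar>real (f u) - real (f v)\<bar>"
    by (simp add: abs_mult abs_minus_commute)
  also have "\<dots> \<le> \<bar>s - t\<bar>"
    using mult_left_mono[OF f[OF step.hyps(1)], of "\<bar>s - t\<bar>"] by simp
  finally show ?case using step.IH by linarith
qed simp

section \<open>Word length and geodesic rays\<close>

locale cayley_graph = group G for G :: "('a, 'b) monoid_scheme" (structure) +
  fixes S :: "'a set"
  assumes finite_gen: "finite S" and gen: "generating_set G S"
begin

abbreviation adj :: "'a \<Rightarrow> 'a \<Rightarrow> bool" where "adj \<equiv> Cayley_adj G S"
abbreviation D :: "('a \<Rightarrow> real) \<Rightarrow> ('a \<Rightarrow> real) \<Rightarrow> real" where "D \<equiv> Cay_dist G S"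

definition edges :: "('a \<times> 'a) set" where "edges = {(g, h). adj g h}"

text \<open>Word length in the generators and their inverses, as the combinatorial distance from the
  unit.\<close>

definition wlen :: "'a \<Rightarrow> nat" where "wlen g = (LEAST k. (\<one>, g) \<in> edges ^^ k)"

sublocale Cay: Metric_space "Cay G S" D
  using Cay_metric gen is_group by blast

lemma gens: "S \<subseteq> carrier G" "generate G S = carrier G"
  using gen unfolding generating_set_def by auto

lemma adj_sym: "adj g h \<Longrightarrow> adj h g"
  unfolding Cayley_adj_def by blast

lemma adj_carrier: "adj g h \<Longrightarrow> g \<in> carrier G" "adj g h \<Longrightarrow> h \<in> carrier G"
  unfolding Cayley_adj_def by blast+

lemma adj_translate:
  assumes "adj g h" "a \<in> carrier G"
  shows "adj (a \<otimes> g) (a \<otimes> h)"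
proof -
  obtain s where s: "s \<in> S" "h = g \<otimes> s \<or> g = h \<otimes> s" and gh: "g \<in> carrier G" "h \<in> carrier G" "g \<noteq> h"
    using assms(1) unfolding Cayley_adj_def by blast
  have "s \<in> carrier G" using s(1) gens(1) by blast
  then have "a \<otimes> h = a \<otimes> g \<otimes> s \<or> a \<otimes> g = a \<otimes> h \<otimes> s"
    using s(2) gh assms(2) by (metis m_assoc)
  then show ?thesis
    using s(1) gh assms(2) unfolding Cayley_adj_def by (metis Units_eq Units_l_cancel m_closed)
qed

text \<open>Local finiteness, which follows from finiteness of \<open>S\<close> and is what Koenig's
  lemma needs.\<close>

lemma finite_neighbours: "finite {h. adj g h}"
proof (rule finite_subset)
  show "{h. adj g h} \<subseteq> (\<lambda>s. g \<otimes> s) ` S \<union> (\<lambda>s. g \<otimes> inv s) ` S"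
  proof
    fix h assume "h \<in> {h. adj g h}"
    then obtain s where s: "s \<in> S" "h = g \<otimes> s \<or> g = h \<otimes> s" "h \<in> carrier G"
      unfolding Cayley_adj_def by blast
    then have "s \<in> carrier G" using gens(1) by blast
    then have "h = g \<otimes> s \<or> h = g \<otimes> inv s" using s by (metis inv_solve_right m_closed)
    then show "h \<in> (\<lambda>s. g \<otimes> s) ` S \<union> (\<lambda>s. g \<otimes> inv s) ` S" using s(1) by blast
  qed
  show "finite ((\<lambda>s. g \<otimes> s) ` S \<union> (\<lambda>s. g \<otimes> inv s) ` S)" using finite_gen by simp
qed

lemma edges_pow_translate:
  "(g, h) \<in> edges ^^ k \<Longrightarrow> a \<in> carrier G \<Longrightarrow> (a \<otimes> g, a \<otimes> h) \<in> edges ^^ k"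
  by (induction k arbitrary: h) (auto simp: edges_def intro: adj_translate)

lemma edges_pow_sym: "(g, h) \<in> edges ^^ k \<Longrightarrow> (h, g) \<in> edges ^^ k"
proof (induction k arbitrary: h)
  case (Suc k)
  then obtain x where "(g, x) \<in> edges ^^ k" "(x, h) \<in> edges" by auto
  then have "(h, x) \<in> edges" "(x, g) \<in> edges ^^ k" using Suc.IH by (auto simp: edges_def adj_sym)
  then show ?case by (rule relpow_Suc_I2)
qed simp

lemma edges_reachable: "g \<in> carrier G \<Longrightarrow> \<exists>k. (\<one>, g) \<in> edges ^^ k"
proof -
  have "(g, g \<otimes> h) \<in> edges\<^sup>*" if "h \<in> generate G S" "g \<in> carrier G" for g h
    using that
  proof (induction arbitrary: g rule: generate.induct)
    case one
    then show ?case by simp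
  next
    case (incl h)
    then show ?case using gens(1)
      by (cases "g = g \<otimes> h") (auto simp: edges_def Cayley_adj_def intro!: r_into_rtrancl)
  next
    case (inv h)
    then have h: "h \<in> carrier G" using gens(1) by auto
    then have "g = g \<otimes> inv h \<otimes> h" using inv.prems by (simp add: m_assoc)
    then have "g \<noteq> g \<otimes> inv h \<Longrightarrow> adj g (g \<otimes> inv h)"
      using inv h unfolding Cayley_adj_def by blast
    then show ?case
      by (cases "g = g \<otimes> inv h") (auto simp: edges_def)
  next
    case (eng h1 h2)
    then have "h1 \<in> carrier G" "h2 \<in> carrier G" using gens by auto
    with eng.IH(1)[of g] eng.IH(2)[of "g \<otimes> h1"] eng.prems show ?case
      by (auto simp: m_assoc intro: rtrancl_trans)
  qed
  from this[of g \<one>] show "g \<in> carrier G \<Longrightarrow> \<exists>k. (\<one>, g) \<in> edges ^^ k"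
    using gens(2) by (simp add: rtrancl_power)
qed

lemma wlen_path: "g \<in> carrier G \<Longrightarrow> (\<one>, g) \<in> edges ^^ wlen g"
  using edges_reachable unfolding wlen_def by (meson LeastI_ex)

lemma wlen_le: "(\<one>, g) \<in> edges ^^ k \<Longrightarrow> wlen g \<le> k"
  unfolding wlen_def by (rule Least_le)

lemma wlen_one [simp]: "wlen \<one> = 0"
  using wlen_le[of \<one> 0] by simp

lemma wlen_pow: "g \<in> carrier G \<Longrightarrow> (g, h) \<in> edges ^^ k \<Longrightarrow> wlen h \<le> wlen g + k"
  using wlen_path[of g] wlen_le[of h "wlen g + k"] by (auto simp: relpow_add)

lemma wlen_adj: "adj g h \<Longrightarrow> wlen h \<le> wlen g + 1"
  using wlen_pow[of g h 1] by (auto simp: edges_def adj_carrier)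

lemma wlen_adj_abs: "adj g h \<Longrightarrow> \<bar>real (wlen g) - real (wlen h)\<bar> \<le> 1"
  using wlen_adj[of g h] wlen_adj[of h g] adj_sym by force

text \<open>Left multiplication by \<open>g\<close> carries a walk from the unit to \<open>a\<close>
  to a walk from \<open>g\<close> to \<open>g \<otimes> a\<close>. The two bounds confine a
  translated ball to a band of levels around \<open>wlen g\<close>.\<close>

lemma wlen_mult:
  assumes "g \<in> carrier G" "a \<in> carrier G"
  shows "wlen (g \<otimes> a) \<le> wlen g + wlen a" "wlen g \<le> wlen (g \<otimes> a) + wlen a"
proof -
  have "(g, g \<otimes> a) \<in> edges ^^ wlen a"
    using edges_pow_translate[OF wlen_path[OF assms(2)] assms(1)] assms by simp
  then show "wlen (g \<otimes> a) \<le> wlen g + wlen a" "wlen g \<le> wlen (g \<otimes> a) + wlen a"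
    using wlen_pow edges_pow_sym assms by auto
qed

text \<open>Koenig's lemma, applied to the vertices beyond which infinitely many geodesics from
  the unit continue.\<close>

lemma geodesic_ray:
  assumes "infinite (carrier G)"
  obtains v where "\<And>k::nat. v k \<in> carrier G" "\<And>k. wlen (v k) = k" "\<And>k. adj (v k) (v (Suc k))"
proof -
  \<comment> \<open>For \<open>g\<close> in the group, these are the vertices \<open>w\<close> that
    some geodesic from the unit reaches through \<open>g\<close>.\<close>
  define beyond where "beyond g = {w. \<exists>j. (g, w) \<in> edges ^^ j \<and> wlen w = wlen g + j}" for g
  have "\<exists>v. \<forall>k. (v k \<in> carrier G \<and> wlen (v k) = k \<and> infinite (beyond (v k))) \<and> adj (v k) (v (Suc k))"
  proof (rule dependent_nat_choice)
    have "carrier G \<subseteq> beyond \<one>" using wlen_path by (auto simp: beyond_def)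
    then show "\<exists>x. x \<in> carrier G \<and> wlen x = 0 \<and> infinite (beyond x)"
      using assms by (intro exI[of _ \<one>]) (auto dest: finite_subset)
  next
    fix g k assume g: "g \<in> carrier G \<and> wlen g = k \<and> infinite (beyond g)"
    have "beyond g \<subseteq> {g} \<union> (\<Union>h\<in>{h. adj g h \<and> wlen h = Suc k}. beyond h)"
    proof
      fix w assume "w \<in> beyond g"
      then obtain j where j: "(g, w) \<in> edges ^^ j" "wlen w = k + j" using g by (auto simp: beyond_def)
      show "w \<in> {g} \<union> (\<Union>h\<in>{h. adj g h \<and> wlen h = Suc k}. beyond h)"
      proof (cases j)
        case 0
        then show ?thesis using j by simp
      next
        case (Suc i)
        then obtain h where h: "adj g h" "(h, w) \<in> edges ^^ i"
          using j(1) relpow_Suc_D2[of g w i edges] by (auto simp: edges_def)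
        \<comment> \<open>Each edge raises the word length by at most one and the total rise is
          \<open>j\<close>, so no edge can fall short.\<close>
        then have "wlen h \<le> Suc k" "wlen w \<le> wlen h + i"
          using wlen_adj[of g h] wlen_pow[of h w i] g adj_carrier by auto
        then have "wlen h = Suc k" "wlen w = wlen h + i" using j(2) Suc by auto
        then show ?thesis using h by (auto simp: beyond_def)
      qed
    qed
    then have "infinite ({g} \<union> (\<Union>h\<in>{h. adj g h \<and> wlen h = Suc k}. beyond h))"
      using g infinite_super by blast
    moreover have "finite {h. adj g h \<and> wlen h = Suc k}"
      using finite_neighbours[of g] by (rule rev_finite_subset) auto
    ultimately obtain h where "adj g h" "wlen h = Suc k" "infinite (beyond h)" by auto
    then show "\<exists>h. (h \<in> carrier G \<and> wlen h = Suc k \<and> infinite (beyond h)) \<and> adj g h"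
      using adj_carrier by blast
  qed
  then show ?thesis using that by blast
qed

section \<open>Left translation and height on the Cayley graph\<close>

text \<open>Left multiplication by \<open>a\<close>, acting on barycentric coordinates. The value 0
  outside the carrier fits the points of the realization, which vanish there.\<close>

definition translate :: "'a \<Rightarrow> ('a \<Rightarrow> real) \<Rightarrow> 'a \<Rightarrow> real" where
  "translate a p = (\<lambda>x. if x \<in> carrier G then p (inv a \<otimes> x) else 0)"

lemma translate_edge_point:
  assumes "a \<in> carrier G" "u \<in> carrier G" "v \<in> carrier G"
  shows "translate a (edge_point u v t) = edge_point (a \<otimes> u) (a \<otimes> v) t"
proof
  fix x
  have "inv a \<otimes> x = w \<longleftrightarrow> x = a \<otimes> w" if "x \<in> carrier G" "w \<in> carrier G" for w
    using assms(1) that by (metis inv_solve_left)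
  then show "translate a (edge_point u v t) x = edge_point (a \<otimes> u) (a \<otimes> v) t x"
    using assms by (auto simp: translate_def edge_point_def)
qed

lemma path_length_translate:
  "path_length adj p q l \<Longrightarrow> a \<in> carrier G \<Longrightarrow> path_length adj (translate a p) (translate a q) l"
proof (induction rule: path_length.induct)
  case (step u v s t q l)
  then have "u \<in> carrier G" "v \<in> carrier G" using adj_carrier by auto
  then show ?case
    using step path_length.step[of adj "a \<otimes> u" "a \<otimes> v" s t "translate a q" l] adj_translate
    by (simp add: translate_edge_point)
qed (rule path_length.refl)

lemma translate_inv:
  assumes "a \<in> carrier G" "p \<in> Cay G S"
  shows "translate (inv a) (translate a p) = p"
proof -
  obtain u v t where p: "p = edge_point u v t" and uv: "u \<in> carrier G" "v \<in> carrier G"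
    using assms(2) unfolding Cay_def by (elim realizationE)
  have "inv a \<otimes> (a \<otimes> u) = u" "inv a \<otimes> (a \<otimes> v) = v"
    using assms(1) uv by (simp_all add: m_assoc[symmetric])
  then show ?thesis unfolding p using assms(1) uv by (simp add: translate_edge_point)
qed

text \<open>Paths are carried forward by \<open>a\<close> and back by \<open>inv a\<close>, so both
  pairs of points have the same path lengths.\<close>

lemma dist_translate:
  assumes "a \<in> carrier G" "p \<in> Cay G S" "q \<in> Cay G S"
  shows "D (translate a p) (translate a q) = D p q"
proof -
  have "path_length adj (translate a p) (translate a q) l \<longleftrightarrow> path_length adj p q l" for l
    using path_length_translate[of _ _ l] translate_inv assms by (metis inv_closed)
  then show ?thesis unfolding Cay_dist_def graph_dist_def by presburger
qed

lemma realization_in_Cay: "W \<subseteq> carrier G \<Longrightarrow> realization W adj \<subseteq> Cay G S"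
  unfolding Cay_def by (rule realization_mono)

lemma vertex_in_Cay: "g \<in> carrier G \<Longrightarrow> vertex g \<in> Cay G S"
  unfolding Cay_def by (rule vertex_in_realization)

lemma dist_edge:
  assumes "u \<in> carrier G" "u = v \<or> adj u v" "s \<in> {0..1}" "t \<in> {0..1}"
  shows "D (edge_point u v s) (edge_point u v t) \<le> \<bar>s - t\<bar>"
proof (cases "u = v")
  case True
  then have "D (edge_point u v s) (edge_point u v t) = 0"
    using vertex_in_Cay[OF assms(1)] by (simp add: edge_point_vertex)
  then show ?thesis by simp
next
  case False
  then have "path_length adj (edge_point u v s) (edge_point u v t) (\<bar>s - t\<bar> + 0)"
    using assms by (intro path_length.intros) auto
  then show ?thesis unfolding Cay_dist_def using graph_dist_le by fastforce
qed

lemma dist_vertex_le: "(\<one>, g) \<in> edges ^^ k \<Longrightarrow> D (vertex \<one>) (vertex g) \<le> real k"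
proof (induction k arbitrary: g)
  case 0
  have "vertex \<one> \<in> Cay G S" by (rule vertex_in_Cay) simp
  then show ?case using 0 by simp
next
  case (Suc k)
  then obtain h where h: "(\<one>, h) \<in> edges ^^ k" "adj h g" by (auto simp: edges_def)
  then have "vertex \<one> \<in> Cay G S" "vertex h \<in> Cay G S" "vertex g \<in> Cay G S"
    using adj_carrier[OF h(2)] by (simp_all add: vertex_in_Cay)
  then have "D (vertex \<one>) (vertex g) \<le> D (vertex \<one>) (vertex h) + D (vertex h) (vertex g)"
    by (rule Cay.triangle)
  moreover have "D (vertex h) (vertex g) \<le> 1"
    using dist_edge[of h g 0 1] h(2) adj_carrier by (simp add: edge_point_vertex)
  ultimately show ?case using Suc.IH[OF h(1)] by simp
qed

text \<open>A substitute for the distance from the unit, from which it differs by a bounded amount;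
  being affine on edges, it has level sets that can be read off from the end points.\<close>

definition height :: "('a \<Rightarrow> real) \<Rightarrow> real" where "height = affine_ext wlen"

lemma height_edge_point: "height (edge_point u v t) = (1 - t) * real (wlen u) + t * real (wlen v)"
  by (simp add: height_def affine_ext_edge_point)

lemma height_lipschitz:
  assumes "p \<in> Cay G S" "q \<in> Cay G S"
  shows "\<bar>height p - height q\<bar> \<le> D p q"
proof (cases "\<exists>l. path_length adj p q l")
  case True
  then show ?thesis
    unfolding height_def Cay_dist_def
    using graph_dist_ge affine_ext_lipschitz[of adj wlen, OF wlen_adj_abs] by metis
next
  \<comment> \<open>Here \<open>graph_dist\<close> has its dummy value 0, and the metric axioms then
    force \<open>p = q\<close>.\<close>
  case False
  then have "D p q = 0" by (simp add: Cay_dist_def graph_dist_def)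
  then show ?thesis using assms by simp
qed

lemma wlen_le_height:
  assumes "u = v \<or> adj u v" "0 \<le> t" "t \<le> 1"
  shows "real (wlen u) \<le> height (edge_point u v t) + 1"
    and "real (wlen v) \<le> height (edge_point u v t) + 1"
proof -
  have "\<bar>real (wlen u) - real (wlen v)\<bar> \<le> 1" using assms(1) wlen_adj_abs by auto
  then have "\<bar>t * (real (wlen u) - real (wlen v))\<bar> \<le> 1" "\<bar>(1 - t) * (real (wlen u) - real (wlen v))\<bar> \<le> 1"
    unfolding abs_mult using assms by (auto intro!: mult_le_one)
  then show "real (wlen u) \<le> height (edge_point u v t) + 1"
    and "real (wlen v) \<le> height (edge_point u v t) + 1"
    unfolding height_edge_point by (simp_all add: algebra_simps)
qed

text \<open>The route goes through an end \<open>u\<close> of an edge containing \<open>p\<close>: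
  at most 1 is spent on the edge, and \<open>u\<close> may lie higher than \<open>p\<close> by at
  most 1.\<close>

lemma dist_one_le_height:
  assumes "p \<in> Cay G S"
  shows "D (vertex \<one>) p \<le> height p + 2"
proof -
  obtain u v t where p: "p = edge_point u v t" "u \<in> carrier G" "v \<in> carrier G" "u = v \<or> adj u v"
    "0 \<le> t" "t \<le> 1"
    using assms unfolding Cay_def by (elim realizationE)
  have "vertex \<one> \<in> Cay G S" "vertex u \<in> Cay G S"
    using p(2) by (simp_all add: vertex_in_Cay)
  then have "D (vertex \<one>) p \<le> D (vertex \<one>) (vertex u) + D (vertex u) p"
    using assms by (intro Cay.triangle)
  moreover have "D (vertex u) p \<le> 1"
    using dist_edge[of u v 0 t] p by (simp add: edge_point_vertex)
  moreover have "D (vertex \<one>) (vertex u) \<le> real (wlen u)"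
    using dist_vertex_le wlen_path p(2) by blast
  moreover have "real (wlen u) \<le> height p + 1"
    using wlen_le_height(1)[OF p(4-6)] p(1) by simp
  ultimately show ?thesis by linarith
qed

lemma dist_le_height:
  assumes "p \<in> Cay G S" "q \<in> Cay G S"
  shows "D p q \<le> height p + height q + 4"
proof -
  have "D p q \<le> D p (vertex \<one>) + D (vertex \<one>) q"
    using assms by (intro Cay.triangle) (simp_all add: vertex_in_Cay)
  then show ?thesis
    using dist_one_le_height[OF assms(1)] dist_one_le_height[OF assms(2)]
    by (simp add: Cay.commute)
qed

lemma continuous_map_height:
  assumes "X \<subseteq> Cay G S"
  shows "continuous_map (Metric_space.mtopology X D) euclideanreal height"
proof -
  interpret X: Metric_space X D using assms by (rule Cay.subspace)
  show ?thesis
    unfolding X.continuous_map_from_metric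
  proof (intro conjI ballI allI impI)
    fix a U assume a: "a \<in> X" and U: "openin euclideanreal U \<and> height a \<in> U"
    then obtain r where r: "r > 0" "ball (height a) r \<subseteq> U"
      using open_contains_ball by (metis open_openin)
    have "height x \<in> U" if "x \<in> X" "D a x < r" for x
    proof -
      have "a \<in> Cay G S" "x \<in> Cay G S" using a that(1) assms by auto
      then have "dist (height a) (height x) < r"
        using height_lipschitz[of a x] that(2) by (simp add: dist_real_def)
      then show ?thesis using r(2) by auto
    qed
    with r(1) show "\<exists>r>0. \<forall>x. x \<in> X \<and> D a x < r \<longrightarrow> height x \<in> U" by blast
  qed simp
qed

text \<open>On an edge \<open>D\<close> is at most the length of the segment, so edges are
  continuous images of an interval in the restricted metric; walks inside \<open>W\<close> chain
  them together.\<close>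

lemma connected_space_realization:
  assumes W: "W \<subseteq> carrier G" and reach: "\<And>u. u \<in> W \<Longrightarrow> (w, u) \<in> (edges \<inter> W \<times> W)\<^sup>*" and w: "w \<in> W"
  shows "connected_space (Metric_space.mtopology (realization W adj) D)"
proof -
  let ?X = "realization W adj"
  interpret X: Metric_space ?X D using realization_in_Cay[OF W] by (rule Cay.subspace)
  have edge: "connected_component_of X.mtopology (edge_point u v s) (edge_point u v t)"
    if uv: "u \<in> W" "v \<in> W" "u = v \<or> adj u v" and st: "s \<in> {0..1}" "t \<in> {0..1}" for u v s t
  proof -
    have "continuous_map (top_of_set {0..1}) X.mtopology (edge_point u v)"
      unfolding X.continuous_map_to_metric
    proof (intro ballI allI impI)
      fix x \<epsilon> :: real assume x: "x \<in> topspace (top_of_set {0..1})" and "\<epsilon> > 0"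
      have "edge_point u v y \<in> X.mball (edge_point u v x) \<epsilon>" if y: "y \<in> {0..1} \<inter> ball x \<epsilon>" for y
      proof -
        have "D (edge_point u v x) (edge_point u v y) \<le> \<bar>x - y\<bar>"
          using uv W x y by (intro dist_edge) auto
        also have "\<dots> < \<epsilon>" using y by (simp add: dist_real_def)
        finally show ?thesis using edge_point_in_realization[of u W v adj] uv x y by auto
      qed
      then show "\<exists>U. openin (top_of_set {0..1}) U \<and> x \<in> U \<and>
          (\<forall>y\<in>U. edge_point u v y \<in> X.mball (edge_point u v x) \<epsilon>)"
        using x \<open>\<epsilon> > 0\<close> by (intro exI[of _ "{0..1} \<inter> ball x \<epsilon>"]) (auto simp: openin_open_Int)
    qed
    then have "connectedin X.mtopology (edge_point u v ` {0..1})"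
      by (rule connectedin_continuous_map_image) (simp add: connectedin_subtopology)
    then show ?thesis using st unfolding connected_component_of_def by blast
  qed
  have vert: "connected_component_of X.mtopology (vertex w) (vertex u)" if "u \<in> W" for u
    using reach[OF that]
  proof (induction rule: rtrancl_induct)
    case base
    show ?case using w vertex_in_realization by (auto simp: connected_component_of_refl)
  next
    case (step y z)
    then have "connected_component_of X.mtopology (vertex y) (vertex z)"
      using edge[of y z 0 1] by (auto simp: edges_def edge_point_vertex)
    with step.IH show ?case by (rule connected_component_of_trans)
  qed
  have pt: "connected_component_of X.mtopology (vertex w) p" if pX: "p \<in> ?X" for p
  proof -
    obtain u v t where p: "p = edge_point u v t" "u \<in> W" "v \<in> W" "u = v \<or> adj u v" "0 \<le> t" "t \<le> 1"
      using pX by (elim realizationE)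
    then have "connected_component_of X.mtopology (vertex u) p"
      using edge[of u v 0 t] by (auto simp: edge_point_vertex)
    with vert[OF p(2)] show ?thesis by (rule connected_component_of_trans)
  qed
  show ?thesis
    unfolding connected_space_iff_connected_component
    using pt connected_component_of_sym connected_component_of_trans
    by (metis X.topspace_mtopology)
qed

section \<open>The subgraph and its asymptotic dimension\<close>

text \<open>The Cayley graph is then bounded, and the cover by the whole space works at every
  scale.\<close>

lemma asdim_le_0_if_finite:
  assumes "finite (carrier G)"
  shows "asdim_le (Cay G S) D 0"
proof -
  obtain N where N: "\<And>g. g \<in> carrier G \<Longrightarrow> wlen g \<le> N"
    using assms finite_nat_set_iff_bounded_le[of "wlen ` carrier G"] by auto
  have h: "height p \<le> real N" if pC: "p \<in> Cay G S" for p
  proof -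
    obtain u v t where p: "p = edge_point u v t" "u \<in> carrier G" "v \<in> carrier G" "0 \<le> t" "t \<le> 1"
      using pC unfolding Cay_def by (elim realizationE)
    have "(1 - t) * real (wlen u) + t * real (wlen v) \<le> real N"
      using p N by (intro convex_bound_le) auto
    then show ?thesis by (simp add: p(1) height_edge_point)
  qed
  have "D p q \<le> 2 * real N + 4" if "p \<in> Cay G S" "q \<in> Cay G S" for p q
    using dist_le_height[OF that] h[OF that(1)] h[OF that(2)] by linarith
  then have "uniformly_bounded D {Cay G S}"
    unfolding uniformly_bounded_def by blast
  moreover have "finite {U\<in>{Cay G S}. P U} \<and> card {U\<in>{Cay G S}. P U} \<le> 0 + 1" for P
    using card_mono[of "{Cay G S}" "{U\<in>{Cay G S}. P U}"] by auto
  ultimately show ?thesis unfolding asdim_le_def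
    by (intro allI impI exI[of _ "{Cay G S}"]) auto
qed

text \<open>A finite set of points touches only edges within some ball around the unit, and
  \<open>balls\<close> gives a translation of that ball into \<open>W\<close>. The other inequality
  is monotonicity under subsets.\<close>

lemma asdim_realization_eq_asdim_Cay:
  assumes W: "W \<subseteq> carrier G" and balls: "\<And>i. \<exists>a\<in>carrier G. \<forall>g\<in>carrier G. wlen g \<le> i \<longrightarrow> a \<otimes> g \<in> W"
  shows "asdim (realization W adj) D = asdim (Cay G S) D"
proof -
  let ?X = "realization W adj"
  have X: "?X \<subseteq> Cay G S" using W by (rule realization_in_Cay)
  have "asdim_le (Cay G S) D n" if le: "asdim_le ?X D n" for n
  proof (rule asdim_le_finite_embed[OF Cay.Metric_space_axioms Cay.subspace[OF X] le])
    fix F assume F: "finite F" "F \<subseteq> Cay G S"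
    obtain B where B: "\<And>p. p \<in> F \<Longrightarrow> height p \<le> B"
      using bdd_above_finite[of "height ` F"] F(1) unfolding bdd_above_def by auto
    \<comment> \<open>The summand 1 allows for end points of an edge that lie above the point
      \<open>p\<close> on it.\<close>
    define i where "i = nat \<lceil>B + 1\<rceil>"
    obtain a where a: "a \<in> carrier G" "\<And>g. g \<in> carrier G \<Longrightarrow> wlen g \<le> i \<Longrightarrow> a \<otimes> g \<in> W"
      using balls by blast
    have "translate a p \<in> ?X" if pF: "p \<in> F" for p
    proof -
      obtain u v t where p: "p = edge_point u v t" "u \<in> carrier G" "v \<in> carrier G" "u = v \<or> adj u v"
        "0 \<le> t" "t \<le> 1"
        using pF F(2) unfolding Cay_def by (blast elim: realizationE)
      have "real (wlen u) \<le> B + 1" "real (wlen v) \<le> B + 1"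
        using wlen_le_height[OF p(4-6)] B[OF pF] p(1) by auto
      then have "wlen u \<le> i" "wlen v \<le> i" unfolding i_def by linarith+
      then have "a \<otimes> u \<in> W" "a \<otimes> v \<in> W" using a(2) p by auto
      moreover have "a \<otimes> u = a \<otimes> v \<or> adj (a \<otimes> u) (a \<otimes> v)" using p(4) adj_translate a(1) by blast
      ultimately show ?thesis
        using p a(1) by (auto simp: translate_edge_point intro: edge_point_in_realization)
    qed
    moreover have "D (translate a p) (translate a q) = D p q" if "p \<in> F" "q \<in> F" for p q
      using dist_translate[OF a(1)] that F(2) by blast
    ultimately show "\<exists>T. T ` F \<subseteq> ?X \<and> (\<forall>x\<in>F. \<forall>y\<in>F. D (T x) (T y) = D x y)"
      by (intro exI[of _ "translate a"]) auto
  qed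
  then have "asdim_le ?X D = asdim_le (Cay G S) D"
    using asdim_le_subset[OF Cay.Metric_space_axioms X] by blast
  then show ?thesis unfolding asdim_def by simp
qed

text \<open>Balls of radius \<open>i\<close> are strung on a geodesic ray at distance \<open>(i + 2)\<^sup>2\<close> from the unit, so that
  they occupy levels with gaps of length at least 2 in between.\<close>

lemma string_of_balls:
  assumes "infinite (carrier G)"
  obtains W where "W \<subseteq> carrier G" "connected_space (Metric_space.mtopology (realization W adj) D)"
    "\<And>i. \<exists>a\<in>carrier G. \<forall>g\<in>carrier G. wlen g \<le> i \<longrightarrow> a \<otimes> g \<in> W"
    "\<And>i. \<exists>k\<ge>i. \<exists>y z. \<forall>g\<in>W. (wlen g = k \<longrightarrow> g = y) \<and> (wlen g = Suc k \<longrightarrow> g = z)"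
proof -
  obtain v :: "nat \<Rightarrow> 'a" where v: "\<And>k. v k \<in> carrier G" "\<And>k. wlen (v k) = k" "\<And>k. adj (v k) (v (Suc k))"
    using geodesic_ray[OF assms] by blast
  define m :: "nat \<Rightarrow> nat" where "m i = (i + 2)\<^sup>2" for i
  define W where "W = range v \<union> {v (m i) \<otimes> a | i a. a \<in> carrier G \<and> wlen a \<le> i}"
  have vW: "v k \<in> W" for k unfolding W_def by blast
  have ballW: "v (m i) \<otimes> a \<in> W" if "a \<in> carrier G" "wlen a \<le> i" for i a
    unfolding W_def using that by blast
  have W: "W \<subseteq> carrier G" unfolding W_def using v(1) by auto
  let ?E = "edges \<inter> W \<times> W"
  have ray: "(v 0, v k) \<in> ?E\<^sup>*" for k
  proof (induction k)
    case (Suc k)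
    have "(v k, v (Suc k)) \<in> ?E" using v(3) vW by (simp add: edges_def)
    with Suc show ?case by (rule rtrancl_into_rtrancl)
  qed simp
  \<comment> \<open>A walk of length at most \<open>i\<close> from the unit never leaves the ball of
    radius \<open>i\<close>, so its translate stays inside \<open>W\<close>.\<close>
  have ball: "(v (m i), v (m i) \<otimes> a) \<in> ?E\<^sup>*" if "(\<one>, a) \<in> edges ^^ j" "j \<le> i" for i j a
    using that
  proof (induction j arbitrary: a)
    case 0
    then have "v (m i) \<otimes> a = v (m i)" using v(1)[of "m i"] by auto
    then show ?case by simp
  next
    case (Suc j)
    then obtain b where b: "(\<one>, b) \<in> edges ^^ j" "adj b a" by (auto simp: edges_def)
    have "wlen b \<le> i" "wlen a \<le> i" using wlen_le[OF b(1)] wlen_le[OF Suc.prems(1)] Suc.prems(2) by auto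
    then have "(v (m i) \<otimes> b, v (m i) \<otimes> a) \<in> ?E"
      using adj_translate[OF b(2)] v(1) ballW adj_carrier[OF b(2)] by (simp add: edges_def)
    moreover have "(v (m i), v (m i) \<otimes> b) \<in> ?E\<^sup>*" using Suc.IH[OF b(1)] Suc.prems(2) by simp
    ultimately show ?case by (rule rtrancl_into_rtrancl[rotated])
  qed
  have "(v 0, u) \<in> ?E\<^sup>*" if u: "u \<in> W" for u
  proof -
    consider k where "u = v k" | i a where "u = v (m i) \<otimes> a" "a \<in> carrier G" "wlen a \<le> i"
      using u unfolding W_def by blast
    then show ?thesis
    proof cases
      case 1
      then show ?thesis using ray by simp
    next
      case 2
      then show ?thesis using ray[of "m i"] ball[OF wlen_path[OF 2(2)] 2(3)] by (auto intro: rtrancl_trans)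
    qed
  qed
  then have "connected_space (Metric_space.mtopology (realization W adj) D)"
    by (rule connected_space_realization[OF W _ vW])
  moreover have "\<exists>a\<in>carrier G. \<forall>g\<in>carrier G. wlen g \<le> i \<longrightarrow> a \<otimes> g \<in> W" for i
    using v(1) ballW by blast
  moreover have "\<exists>k\<ge>i. \<exists>y z. \<forall>g\<in>W. (wlen g = k \<longrightarrow> g = y) \<and> (wlen g = Suc k \<longrightarrow> g = z)" for i
  proof -
    \<comment> \<open>Ball \<open>i\<close> ends at level \<open>m i + i\<close>, and ball
      \<open>i + 1\<close> starts no lower than \<open>m i + i + 4\<close>; hence the levels
      \<open>k\<close> and \<open>Suc k\<close> contain vertices of the ray only.\<close>
    define k where "k = m i + i + 1"
    have "g = v (wlen g)" if g: "g \<in> W" "wlen g = k \<or> wlen g = Suc k" for g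
    proof (rule ccontr)
      assume "g \<noteq> v (wlen g)"
      then obtain j a where a: "g = v (m j) \<otimes> a" "a \<in> carrier G" "wlen a \<le> j"
        using g(1) v(2) unfolding W_def by auto
      then have le: "wlen g \<le> m j + j" "m j \<le> wlen g + j"
        using wlen_mult[OF v(1)[of "m j"] a(2)] v(2) by auto
      show False
      proof (cases "j \<le> i")
        case True
        then have "m j \<le> m i" unfolding m_def by (simp add: power_mono)
        with True le(1) g(2) show False unfolding k_def by linarith
      next
        case False
        \<comment> \<open>The substitution \<open>j = i + 1 + e\<close> turns the comparison of
          \<open>m j - j\<close> with \<open>m i + i + 2\<close> into one between sums of
          nonnegative terms.\<close>
        then have "i + 1 \<le> j" by simp
        then obtain e where "j = i + 1 + e" using le_Suc_ex by blast
        then have "m j = m i + 2 * i + 5 + e * e + 2 * (e * i) + 6 * e"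
          unfolding m_def by (simp add: power2_eq_square algebra_simps)
        with \<open>j = i + 1 + e\<close> have "m i + i + 2 < m j - j" by simp
        with le(2) g(2) show False unfolding k_def by linarith
      qed
    qed
    moreover have "i \<le> k" unfolding k_def by simp
    ultimately show ?thesis
      by (intro exI[of _ k] conjI exI[of _ "v k"] exI[of _ "v (Suc k)"]) fastforce+
  qed
  ultimately show ?thesis by (rule that[OF W])
qed

lemma Cantor_manifold:
  assumes inf: "infinite (carrier G)" and n: "asdim (Cay G S) D = enat n" "2 \<le> n"
  shows "\<exists>X\<subseteq>Cay G S. asymptotic_Cantor_manifold n X D"
proof -
  obtain W where W: "W \<subseteq> carrier G"
    and conn: "connected_space (Metric_space.mtopology (realization W adj) D)"
    and balls: "\<And>i. \<exists>a\<in>carrier G. \<forall>g\<in>carrier G. wlen g \<le> i \<longrightarrow> a \<otimes> g \<in> W"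
    and gaps: "\<And>i. \<exists>k\<ge>i. \<exists>y z. \<forall>g\<in>W. (wlen g = k \<longrightarrow> g = y) \<and> (wlen g = Suc k \<longrightarrow> g = z)"
    by (fact string_of_balls[OF inf])
  let ?X = "realization W adj"
  have X: "?X \<subseteq> Cay G S" using W by (rule realization_in_Cay)
  interpret X: Metric_space ?X D using X by (rule Cay.subspace)
  have bdd: "X.mbounded {x\<in>?X. height x \<le> r}" for r
    unfolding X.mbounded_alt
  proof (intro conjI exI[of _ "2 * r + 4"] ballI)
    fix x y assume "x \<in> {x\<in>?X. height x \<le> r}" "y \<in> {x\<in>?X. height x \<le> r}"
    moreover from this have "D x y \<le> height x + height y + 4" using X by (intro dist_le_height) auto
    ultimately show "D x y \<le> 2 * r + 4" by simp
  qed simp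
  have cut: "\<exists>s\<ge>r. \<exists>p. {x\<in>?X. height x = s} \<subseteq> {p}" for r
  proof -
    obtain k y z where k: "k \<ge> nat \<lceil>r\<rceil>"
      and yz: "\<And>g. g \<in> W \<Longrightarrow> wlen g = k \<Longrightarrow> g = y" "\<And>g. g \<in> W \<Longrightarrow> wlen g = Suc k \<Longrightarrow> g = z"
      using gaps[of "nat \<lceil>r\<rceil>"] by blast
    \<comment> \<open>An edge changes the level by at most one, and an edge within a level has
      integer height, which parity excludes. What remains is an edge between levels \<open>k\<close>
      and \<open>Suc k\<close>, in one of its two orientations, with \<open>x\<close> as its
      midpoint.\<close>
    have "x = edge_point y z (1/2)" if x: "x \<in> ?X" "height x = real k + 1/2" for x
    proof -
      obtain u w t where p: "x = edge_point u w t" "u \<in> W" "w \<in> W" "u = w \<or> adj u w" "0 \<le> t" "t \<le> 1"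
        using x(1) by (elim realizationE)
      have h: "real (wlen u) + t * (real (wlen w) - real (wlen u)) = real k + 1/2"
        using x(2) unfolding p(1) height_edge_point by (simp add: algebra_simps)
      have "wlen w \<le> wlen u + 1" "wlen u \<le> wlen w + 1"
        using p(4) wlen_adj[of u w] wlen_adj[of w u] adj_sym by auto
      then consider "wlen w = wlen u" | "wlen w = wlen u + 1" | "wlen u = wlen w + 1" by linarith
      then show ?thesis
      proof cases
        case 1
        then have "real (2 * wlen u) = real (2 * k + 1)" using h by simp
        then have "2 * wlen u = 2 * k + 1" by (simp only: of_nat_eq_iff)
        then show ?thesis by presburger
      next
        case 2
        then have t: "real (wlen u) + t = real k + 1/2" using h by simp
        then have "wlen u = k" using p(5,6) by linarith
        moreover from this have "t = 1/2" "wlen w = Suc k" using t 2 by simp_all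
        ultimately have "t = 1/2" "u = y" "w = z" by (simp_all add: yz p(2,3))
        then show ?thesis by (simp only: p(1))
      next
        case 3
        then have t: "real (wlen u) - t = real k + 1/2" using h by simp
        then have "wlen w = k" using p(5,6) 3 by linarith
        moreover from this have "t = 1/2" "wlen u = Suc k" using t 3 by simp_all
        ultimately have "t = 1/2" "u = z" "w = y" by (simp_all add: yz p(2,3))
        moreover have "edge_point z y (1/2) = edge_point y z (1/2)"
          using edge_point_swap[of z y "1/2"] by simp
        ultimately show ?thesis by (simp only: p(1))
      qed
    qed
    moreover have "r \<le> real k + 1/2" using k by linarith
    ultimately show ?thesis by blast
  qed
  have "\<not> coarsely_separates ?X D K" if K: "K \<subseteq> ?X" for K
    by (rule not_coarsely_separates_if_cut_points[OF X.Metric_space_axioms conn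
          continuous_map_height[OF X] bdd cut K])
  moreover have "asdim ?X D = enat n" using asdim_realization_eq_asdim_Cay[OF W balls] n(1) by simp
  ultimately show ?thesis
    unfolding asymptotic_Cantor_manifold_def
    using X X.Metric_space_axioms conn n(2) by blast
qed

end

theorem theorem1p5:
  fixes G :: "('a, 'b) monoid_scheme" and S :: "'a set" and n :: nat
  assumes "group G"
    and "finite S" and "generating_set G S"
    and "asdim (Cay G S) (Cay_dist G S) = enat n" and "2 \<le> n"
  shows "\<exists>X \<subseteq> Cay G S. asymptotic_Cantor_manifold n X (Cay_dist G S)"
proof -
  interpret cayley_graph G S
    using assms(1-3) by (simp add: cayley_graph_def cayley_graph_axioms_def)
  \<comment> \<open>A geodesic ray exists only in an infinite group; a finite group has asymptotic
    dimension 0, against \<open>2 \<le> n\<close>.\<close>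
  have "infinite (carrier G)"
  proof
    assume "finite (carrier G)"
    then have "asdim (Cay G S) (Cay_dist G S) \<le> enat 0"
      unfolding asdim_def using asdim_le_0_if_finite by (intro Inf_lower) blast
    with assms(4,5) show False by simp
  qed
  then show ?thesis using assms(4,5) by (rule Cantor_manifold)
qed

end
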